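(* Let $A\in\mathbb{R}^{n\times n}$ be symmetric positive definite, $b\in\mathbb{R}^n$, and $f(x)=x^TAx/2-b^Tx$, with minimizer $x^*$. Suppose the Idealized Algorithm (IA) and linear conjugate gradient (CG) are applied to $f$ with the same starting point $x_0$. Let the sequences of $x$-iterates be denoted $x_k^{\rm IA}$ and $x_k^{\rm CG}$ respectively, let $\mathcal{M}_k$ and $y_k$ be the affine sets and auxiliary points of IA, and let $r_k,p_k$ be the vectors of CG. Let $\mathcal{V}_k=x_0+\mathrm{span}\{r_0,\ldots,r_{k-1}\}$ and $$\tau_k=\frac{2(f(x_k^{\rm CG})-f(x^* ))}{\|r_{k-1}\|^2}.$$ Then for each $k=1,2,\ldots$ (as long as CG has not terminated, i.e. $r_{k-1}\ne 0$): (a) $\mathcal{M}_k\subset\mathcal{V}_k$, (b) $x_k^{\rm CG}=x_k^{\rm IA}$, and (c) $y_k=x_k^{\rm CG}+\tau_kp_k$.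
   Context: Idealized Algorithm (IA): $x_0$ is given; $\mathcal{M}_1:=x_0+\mathrm{span}\{\nabla f(x_0)\}$; for $k=1,2,\ldots$: $x_k:=\mathrm{argmin}\{f(x):x\in\mathcal{M}_k\}$; $y_k:=\mathrm{argmin}\{\|y-x^*\|:y\in\mathcal{M}_k\}$; $\mathcal{M}_{k+1}:=x_k+\mathrm{span}\{y_k-x_k,\nabla f(x_k)\}$. Linear conjugate gradient (CG): $x_0$ is given; $r_0:=b-Ax_0$; $p_1:=r_0$; for $k=1,2,\ldots$: $\alpha_k:=\dfrac{r_{k-1}^Tr_{k-1}}{p_k^TAp_k}$; $x_k:=x_{k-1}+\alpha_kp_k$; $r_k:=r_{k-1}-\alpha_kAp_k$; $\beta_{k+1}:=\dfrac{r_k^Tr_k}{r_{k-1}^Tr_{k-1}}$; $p_{k+1}:=\beta_{k+1}p_k+r_k$. *)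

theory Defs
  imports "HOL-Analysis.Analysis"
begin

definition grad :: "('a::real_inner \<Rightarrow> real) \<Rightarrow> 'a \<Rightarrow> 'a" where
  "grad f x = (THE D. GDERIV f x :> D)"

definition affine_span :: "'a::real_vector \<Rightarrow> 'a set \<Rightarrow> 'a set" where
  "affine_span x S = (\<lambda>v. x + v) ` span S"

text \<open>
  Idealized Algorithm, indexed as \<open>M\<^sub>k\<close>, \<open>x\<^sub>k\<close>, \<open>y\<^sub>k\<close>. The iteration only defines \<open>M\<^sub>k\<close> and \<open>y\<^sub>k\<close>
  for \<open>k \<ge> 1\<close>; their values at index 0 are arbitrary and never used.
\<close>

context
  fixes f :: "'a::real_inner \<Rightarrow> real" and xstar x0 :: 'a
begin

fun IA_M :: "nat \<Rightarrow> 'a set" and IA_x :: "nat \<Rightarrow> 'a" and IA_y :: "nat \<Rightarrow> 'a" where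
  "IA_M 0 = {x0}"
| "IA_M (Suc 0) = affine_span x0 {grad f x0}"
| "IA_M (Suc (Suc k)) =
     affine_span (IA_x (Suc k)) {IA_y (Suc k) - IA_x (Suc k), grad f (IA_x (Suc k))}"
| "IA_x 0 = x0"
| "IA_x (Suc k) = arg_min_on f (IA_M (Suc k))"
| "IA_y 0 = x0"
| "IA_y (Suc k) = arg_min_on (\<lambda>y. norm (y - xstar)) (IA_M (Suc k))"

end

definition CG_alpha :: "real^'n^'n \<Rightarrow> real^'n \<Rightarrow> real^'n \<Rightarrow> real" where
  "CG_alpha A r p = (r \<bullet> r) / (p \<bullet> (A *v p))"

definition CG_beta :: "real^'n \<Rightarrow> real^'n \<Rightarrow> real" where
  "CG_beta r_new r_old = (r_new \<bullet> r_new) / (r_old \<bullet> r_old)"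

text \<open>
  Linear conjugate gradient. The direction \<open>p\<^sub>k\<close> is only defined for \<open>k \<ge> 1\<close>; \<open>CG_p 0\<close> is
  arbitrary and never used. Once a residual vanishes, division by zero (\<open>0 / 0 = 0\<close>) makes
  all later residuals vanish too, so \<open>r\<^sub>k \<noteq> 0\<close> says that no residual up to \<open>k\<close> is zero.
\<close>

context
  fixes A :: "real^'n^'n" and b x0 :: "real^'n"
begin

fun CG_x :: "nat \<Rightarrow> real^'n" and CG_r :: "nat \<Rightarrow> real^'n" and CG_p :: "nat \<Rightarrow> real^'n" where
  "CG_x 0 = x0"
| "CG_x (Suc k) = CG_x k + CG_alpha A (CG_r k) (CG_p (Suc k)) *\<^sub>R CG_p (Suc k)"
| "CG_r 0 = b - A *v x0"
| "CG_r (Suc k) = CG_r k - CG_alpha A (CG_r k) (CG_p (Suc k)) *\<^sub>R (A *v CG_p (Suc k))"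
| "CG_p 0 = 0"
| "CG_p (Suc 0) = CG_r 0"
| "CG_p (Suc (Suc k)) = CG_beta (CG_r (Suc k)) (CG_r k) *\<^sub>R CG_p (Suc k) + CG_r (Suc k)"

definition CG_V :: "nat \<Rightarrow> (real^'n) set" where
  "CG_V k = affine_span x0 (CG_r ` {..<k})"

end

definition quad :: "real^'n^'n \<Rightarrow> real^'n \<Rightarrow> real^'n \<Rightarrow> real" where
  "quad A b x = (x \<bullet> (A *v x)) / 2 - b \<bullet> x"

definition CG_tau :: "real^'n^'n \<Rightarrow> real^'n \<Rightarrow> real^'n \<Rightarrow> real^'n \<Rightarrow> nat \<Rightarrow> real" where
  "CG_tau A b x0 xstar k =
     2 * (quad A b (CG_x A b x0 k) - quad A b xstar) / (norm (CG_r A b x0 (k - 1)))\<^sup>2"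

end

(*
  Writing e = xstar - x_k, the residual r_k = A e is orthogonal to p_1, ..., p_k, and r_{j-1} - r_j
  is a multiple of A p_j.  Hence e . r_j does not depend on j <= k, so it equals
  e . A e = 2 (f x_k - f xstar).  In the same way conjugacy makes p_k . r_j independent of j < k, so
  it equals |r_{k-1}|^2.  Thus e - tau_k p_k is orthogonal to r_0, ..., r_{k-1}, that is,
  x_k + tau_k p_k is the point of V_k closest to xstar, while x_k minimizes f on V_k.
  As long as r_k is nonzero, tau_k is positive, so M_{k+1} contains x_k + span {p_{k+1}} and with it
  both minimizers over V_{k+1}; since M_{k+1} is contained in V_{k+1}, they are the iterates of IA.
*)
theory Submission
  imports Defs
begin

section \<open>Minimizers, gradients and affine spans\<close>

lemma arg_min_on_eqI:
  fixes f :: "'a \<Rightarrow> 'b::order"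
  assumes "x \<in> S" "\<And>z. z \<in> S \<Longrightarrow> z \<noteq> x \<Longrightarrow> f x < f z"
  shows "arg_min_on f S = x"
  unfolding arg_min_on_def arg_min_def is_arg_min_def
\<comment> \<open>\<open>arg_min_on\<close> picks an arbitrary minimizer; the strict inequality
  makes it unique and so determines the choice.\<close>
proof (rule some_equality)
  show "x \<in> S \<and> \<not> (\<exists>y. y \<in> S \<and> f y < f x)"
    using assms by (metis order.asym)
qed (use assms in blast)

lemma grad_eqI:
  assumes "GDERIV f x :> D"
  shows "grad f x = D"
  unfolding grad_def
proof (rule the_equality[where P = "\<lambda>D. GDERIV f x :> D", OF assms])
  fix D' assume "GDERIV f x :> D'"
  with assms have "(\<lambda>h. h \<bullet> D') = (\<lambda>h. h \<bullet> D)"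
    unfolding gderiv_def by (rule has_derivative_unique[rotated])
  then have "(D' - D) \<bullet> (D' - D) = 0"
    by (metis inner_diff_right right_minus_eq)
  then show "D' = D" by simp
qed

lemma orthogonal_span_left:
  assumes "v \<in> span S" "\<And>w. w \<in> S \<Longrightarrow> w \<bullet> a = 0"
  shows "v \<bullet> a = 0"
  using orthogonal_to_span[of v S a] assms
  by (simp add: orthogonal_def inner_commute)

lemma mem_affine_span_iff: "z \<in> affine_span x S \<longleftrightarrow> z - x \<in> span S"
  unfolding affine_span_def by (auto simp: image_iff) (metis add_diff_cancel_left' diff_add_cancel add.commute)

lemma affine_span_subsetI:
  assumes "x \<in> affine_span x' S'" "S \<subseteq> span S'"
  shows "affine_span x S \<subseteq> affine_span x' S'"
proof
  fix z assume "z \<in> affine_span x S"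
  then have "z - x \<in> span S'"
    using assms(2) by (metis mem_affine_span_iff span_mono span_span subsetD)
  then have "(z - x) + (x - x') \<in> span S'"
    using assms(1) by (intro span_add) (simp_all add: mem_affine_span_iff)
  then show "z \<in> affine_span x' S'" by (simp add: mem_affine_span_iff)
qed

section \<open>The quadratic of a symmetric positive definite matrix\<close>

locale spd_matrix =
  fixes A :: "real^'n^'n"
  assumes sym: "transpose A = A"
    and posdef: "\<And>x. x \<noteq> 0 \<Longrightarrow> x \<bullet> (A *v x) > 0"
begin

lemma inner_mult_commute: "x \<bullet> (A *v y) = y \<bullet> (A *v x)"
  by (metis dot_lmul_matrix inner_commute sym transpose_matrix_vector)

text \<open>The exact Taylor expansion, with the negative gradient written in the form of a CG
  residual.\<close>

lemma quad_add: "quad A b (x + h) = quad A b x - h \<bullet> (b - A *v x) + (h \<bullet> (A *v h)) / 2"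
  using inner_mult_commute[of x h]
  by (simp add: quad_def matrix_vector_right_distrib inner_add_left inner_add_right
      inner_diff_right inner_commute[of b] field_simps)

lemma GDERIV_quad: "GDERIV (quad A b) x :> A *v x - b"
proof -
  have "(quad A b has_derivative (\<lambda>h. (x \<bullet> (A *v h) + h \<bullet> (A *v x)) / 2 - b \<bullet> h)) (at x)"
    unfolding quad_def by (auto intro!: derivative_eq_intros bounded_linear_imp_has_derivative
        matrix_vector_mul_bounded_linear)
  moreover have "(x \<bullet> (A *v h) + h \<bullet> (A *v x)) / 2 - b \<bullet> h = h \<bullet> (A *v x - b)" for h
    using inner_mult_commute[of x h] by (simp add: inner_diff_right inner_commute[of b])
  ultimately show ?thesis by (simp add: gderiv_def)
qed

lemma grad_quad: "grad (quad A b) x = A *v x - b"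
  by (rule grad_eqI[OF GDERIV_quad])

text \<open>Fermat's rule: the derivative vanishes at a minimizer, in particular in the direction of
  the gradient itself. This turns minimality into the linear equation that all later arguments
  use.\<close>

lemma minimizer_quad:
  assumes "is_arg_min (quad A b) (\<lambda>x. True) xstar"
  shows "A *v xstar = b"
proof -
  have "(\<lambda>h. h \<bullet> (A *v xstar - b)) = (\<lambda>h. 0)"
    using GDERIV_quad[of b xstar] assms
    by (intro differential_zero_maxmin[of xstar UNIV "quad A b"])
      (auto simp: gderiv_def is_arg_min_def not_less)
  then have "(A *v xstar - b) \<bullet> (A *v xstar - b) = 0" by meson
  then show ?thesis by simp
qed

end

section \<open>Orthogonality and conjugacy in CG\<close>

locale cg = spd_matrix A for A :: "real^'n^'n" +
  fixes b x0 :: "real^'n"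
begin

abbreviation "xs \<equiv> CG_x A b x0"
abbreviation "rs \<equiv> CG_r A b x0"
abbreviation "ps \<equiv> CG_p A b x0"
abbreviation "\<alpha> k \<equiv> CG_alpha A (rs k) (ps (Suc k))"
abbreviation "\<beta> k \<equiv> CG_beta (rs (Suc k)) (rs k)"
abbreviation "V \<equiv> CG_V A b x0"

lemma residual: "rs k = b - A *v xs k"
  by (induction k) (simp_all add: matrix_vector_right_distrib matrix_vector_mult_scaleR)

text \<open>A zero residual makes the numerator of \<beta> zero. This lets the orthogonality
  relations be stated without assuming that CG is still running.\<close>

lemma direction_eq_0:
  assumes "rs k = 0"
  shows "ps (Suc k) = 0"
proof (cases k)
  case (Suc m)
  then have "\<beta> m = 0" using assms by (simp only: CG_beta_def) simp
  then show ?thesis using assms Suc by simp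
qed (use assms in simp)

text \<open>The relations feed one another, so they go through a single strong induction: residuals
  against directions, then against residuals, then conjugacy.\<close>

lemma cg_orthogonality:
  "(\<forall>i<n. rs n \<bullet> rs i = 0 \<and> rs n \<bullet> ps (Suc i) = 0 \<and> ps (Suc n) \<bullet> (A *v ps (Suc i)) = 0)
    \<and> rs n \<bullet> ps (Suc n) = rs n \<bullet> rs n"
proof (induction n rule: less_induct)
  case (less n)
  show ?case
  proof (cases n)
    case 0
    then show ?thesis by simp
  next
    case (Suc m)
    have rp_diag: "rs i \<bullet> ps (Suc i) = rs i \<bullet> rs i" if "i \<le> m" for i
      using less[of i] Suc that by simp
    have rp_m: "rs m \<bullet> ps (Suc i) = 0" and pp_m: "ps (Suc m) \<bullet> (A *v ps (Suc i)) = 0" if "i < m" for i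
      using less[of m] Suc that by simp_all
    \<comment> \<open>Cleared of its denominator, the formula for \<alpha> survives a zero
      direction, since \<open>rp_diag\<close> then gives a zero residual.\<close>
    have \<alpha>_pAp: "\<alpha> i * (ps (Suc i) \<bullet> (A *v ps (Suc i))) = rs i \<bullet> rs i" if "i \<le> m" for i
    proof (cases "ps (Suc i) = 0")
      case True
      then show ?thesis using rp_diag[OF that] by simp
    next
      case False
      then show ?thesis using posdef[OF False] by (simp add: CG_alpha_def)
    qed
    have rp: "rs n \<bullet> ps (Suc i) = 0" if "i \<le> m" for i
    proof (cases "i = m")
      case True
      then show ?thesis using \<alpha>_pAp[of m] rp_diag[of m]
        by (simp add: Suc inner_diff_left inner_commute[of _ "ps (Suc m)"] inner_diff_right)
    next
      case False
      then show ?thesis using that rp_m[of i] pp_m[of i]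
        by (simp add: Suc inner_diff_left inner_diff_right inner_mult_commute[of "ps (Suc i)"]
            inner_commute[of _ "ps (Suc i)"])
    qed
    have rr: "rs n \<bullet> rs i = 0" if "i \<le> m" for i
    proof (cases i)
      case 0
      then show ?thesis using rp[of 0] by simp
    next
      case (Suc j)
      \<comment> \<open>The direction recurrence is solved for the residual, so that
        \<open>rp\<close> applies to both terms.\<close>
      have "rs i = ps (Suc i) - \<beta> j *\<^sub>R ps i" by (simp add: Suc)
      then show ?thesis using rp[of i] rp[of j] that Suc
        by (metis Suc_leD inner_diff_right inner_scaleR_right mult_zero_right diff_zero)
    qed
    have pp: "ps (Suc n) \<bullet> (A *v ps (Suc i)) = 0" if "i \<le> m" for i
    proof (cases "rs i = 0")
      case True
      then show ?thesis using direction_eq_0[OF True] by simp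
    next
      case False
      then have \<alpha>: "\<alpha> i \<noteq> 0" using \<alpha>_pAp[OF that] by auto
      \<comment> \<open>As \<alpha> is nonzero, it suffices to prove conjugacy multiplied by
        \<alpha>, where \<open>A *v ps (Suc i)\<close> becomes a difference of residuals.\<close>
      have Ap: "\<alpha> i *\<^sub>R (A *v ps (Suc i)) = rs i - rs (Suc i)" by simp
      have "\<alpha> i * (ps (Suc n) \<bullet> (A *v ps (Suc i)))
          = rs n \<bullet> (\<alpha> i *\<^sub>R (A *v ps (Suc i))) + \<beta> m * (\<alpha> i * (ps (Suc m) \<bullet> (A *v ps (Suc i))))"
        by (simp add: Suc inner_add_left algebra_simps del: CG_r.simps)
      also have "\<dots> = 0"
      \<comment> \<open>For \<open>i = m\<close> the ratio \<beta> is exactly what makes the two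
        terms cancel; for \<open>i < m\<close> each term vanishes separately.\<close>
      proof (cases "i = m")
        case True
        have "rs n \<bullet> (\<alpha> m *\<^sub>R (A *v ps (Suc m))) = - (rs n \<bullet> rs n)"
          using Ap rr[of m] True Suc by (simp only: inner_diff_right)
        moreover have "\<beta> m * (\<alpha> m * (ps (Suc m) \<bullet> (A *v ps (Suc m)))) = rs n \<bullet> rs n"
          unfolding \<alpha>_pAp[OF order_refl] CG_beta_def Suc using False True by simp
        ultimately show ?thesis using True by simp
      next
        case False
        then have "rs n \<bullet> (\<alpha> i *\<^sub>R (A *v ps (Suc i))) = 0"
          unfolding Ap inner_diff_right using rr[of i] rr[of "Suc i"] that by simp
        then show ?thesis using pp_m[of i] False that by simp
      qed
      finally show ?thesis using \<alpha> by simp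
    qed
    have "rs n \<bullet> ps (Suc n) = rs n \<bullet> rs n"
      using rp[of m] by (simp add: Suc inner_add_right del: CG_r.simps)
    then show ?thesis using rr rp pp Suc by auto
  qed
qed

lemma residual_orthogonal: "i < n \<Longrightarrow> rs n \<bullet> rs i = 0"
  and residual_orthogonal_direction: "i < n \<Longrightarrow> rs n \<bullet> ps (Suc i) = 0"
  and directions_conjugate: "i < n \<Longrightarrow> ps (Suc n) \<bullet> (A *v ps (Suc i)) = 0"
  and residual_inner_direction: "rs n \<bullet> ps (Suc n) = rs n \<bullet> rs n"
  using cg_orthogonality[of n] by simp_all

section \<open>Inner products constant along the residuals, and the sign of
  \<open>CG_tau\<close>\<close>

lemma direction_inner_residual:
  assumes "j \<le> k"
  shows "ps (Suc k) \<bullet> rs j = rs k \<bullet> rs k"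
  using assms
\<comment> \<open>Downward from \<open>j = k\<close>: passing from \<open>rs (Suc j)\<close> to
  \<open>rs j\<close> adds a multiple of \<open>A *v ps (Suc j)\<close>, which conjugacy
  annihilates.\<close>
proof (induction j rule: inc_induct)
  case base
  then show ?case by (simp only: residual_inner_direction inner_commute[of "ps _"])
next
  case (step j)
  then show ?case using directions_conjugate[of j k] by (simp add: inner_diff_right)
qed

lemma error_inner_residual:
  assumes "A *v xstar = b" "j \<le> k"
  shows "(xstar - xs k) \<bullet> rs j = (xstar - xs k) \<bullet> rs k"
  using assms(2)
proof (induction j rule: inc_induct)
  case (step j)
  \<comment> \<open>Symmetry moves \<open>A\<close> onto the error, where it produces the residual
    \<open>rs k\<close>.\<close>
  have "(xstar - xs k) \<bullet> (A *v ps (Suc j)) = ps (Suc j) \<bullet> rs k"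
    unfolding inner_mult_commute[of "xstar - xs k"] residual
    by (simp add: matrix_vector_mult_diff_distrib assms(1))
  also have "\<dots> = 0"
    using step residual_orthogonal_direction[of j k] by (simp only: inner_commute)
  finally show ?case using step by (simp add: inner_diff_right)
qed simp

text \<open>In the expansion around \<open>xs k\<close>, \<open>A\<close> maps the error to the
  residual, so the quadratic term is half the linear one.\<close>

lemma error_energy:
  assumes "A *v xstar = b"
  shows "2 * (quad A b (xs k) - quad A b xstar) = (xstar - xs k) \<bullet> rs k"
proof -
  have "quad A b xstar = quad A b (xs k) - (xstar - xs k) \<bullet> rs k
      + ((xstar - xs k) \<bullet> (A *v (xstar - xs k))) / 2"
    using quad_add[of b "xs k" "xstar - xs k"] by (simp add: residual)
  moreover have "A *v (xstar - xs k) = rs k"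
    by (simp add: residual matrix_vector_mult_diff_distrib assms)
  ultimately show ?thesis by (simp add: field_simps)
qed

lemma CG_tau_pos:
  assumes "A *v xstar = b" "rs k \<noteq> 0" "rs (Suc k) \<noteq> 0"
  shows "CG_tau A b x0 xstar (Suc k) > 0"
proof -
  have r: "rs (Suc k) = A *v (xstar - xs (Suc k))"
    by (simp only: residual matrix_vector_mult_diff_distrib assms(1))
  then have "xstar - xs (Suc k) \<noteq> 0" using assms(3) by force
  then have "(xstar - xs (Suc k)) \<bullet> rs (Suc k) > 0"
    using posdef r by simp
  then show ?thesis
    unfolding CG_tau_def error_energy[OF assms(1)] using assms(2) by simp
qed

section \<open>Minimizers over the affine spaces \<open>V k\<close>\<close>

lemma residual_in_span: "j < k \<Longrightarrow> rs j \<in> span (rs ` {..<k})"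
  by (simp add: span_base)

lemma direction_in_span: "j \<le> k \<Longrightarrow> ps j \<in> span (rs ` {..<k})"
proof (induction j)
  case (Suc j)
  have "rs j \<in> span (rs ` {..<k})" using Suc.prems by (intro residual_in_span) simp
  \<comment> \<open>The case split is needed because the first direction is \<open>rs 0\<close>
    itself, outside the general recurrence.\<close>
  moreover have "ps (Suc j) \<in> span {ps j, rs j}"
    by (cases j) (auto simp: span_base span_add span_scale simp del: CG_r.simps)
  ultimately show ?case
    using Suc span_mono[of "{ps j, rs j}" "span (rs ` {..<k})"] by (auto simp: span_span)
qed (simp add: span_zero)

lemma CG_x_in_V: "j \<le> k \<Longrightarrow> xs j \<in> V k"
proof (induction j)
  case (Suc j)
  have "(xs j - x0) + \<alpha> j *\<^sub>R ps (Suc j) \<in> span (rs ` {..<k})"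
    using Suc direction_in_span[OF Suc.prems]
    by (intro span_add span_scale) (simp_all add: CG_V_def mem_affine_span_iff)
  then show ?case by (simp add: CG_V_def mem_affine_span_iff algebra_simps)
qed (simp add: CG_V_def mem_affine_span_iff span_zero)

lemma diff_in_V:
  assumes "z \<in> V k" "w \<in> V k"
  shows "z - w \<in> span (rs ` {..<k})"
  using span_diff[of "z - x0" "rs ` {..<k}" "w - x0"] assms
  by (simp add: CG_V_def mem_affine_span_iff)

text \<open>Differences within \<open>V k\<close> are orthogonal to \<open>rs k\<close>, so the
  linear term of the expansion drops out and positive definiteness gives strictness.\<close>

lemma CG_x_minimizes:
  assumes "z \<in> V k" "z \<noteq> xs k"
  shows "quad A b (xs k) < quad A b z"
proof -
  let ?h = "z - xs k"
  have "?h \<bullet> rs k = 0"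
    using diff_in_V[OF assms(1) CG_x_in_V[OF order_refl]]
    by (rule orthogonal_span_left) (auto simp: residual_orthogonal inner_commute[of "rs _" "rs k"])
  moreover have "?h \<bullet> (A *v ?h) > 0" using assms(2) by (intro posdef) simp
  ultimately show ?thesis
    using quad_add[of b "xs k" ?h] by (simp add: residual)
qed

text \<open>The closed form claimed for \<open>IA_y\<close>; \<open>nearest_minimizes\<close>
  justifies the name.\<close>

definition "nearest xstar k = xs k + CG_tau A b x0 xstar k *\<^sub>R ps k"

lemma nearest_in_V: "nearest xstar k \<in> V k"
proof -
  have "(xs k - x0) + CG_tau A b x0 xstar k *\<^sub>R ps k \<in> span (rs ` {..<k})"
    using CG_x_in_V[of k k] direction_in_span[of k k]
    by (intro span_add span_scale) (simp_all add: CG_V_def mem_affine_span_iff)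
  then show ?thesis by (simp add: CG_V_def nearest_def mem_affine_span_iff algebra_simps)
qed

lemma nearest_minimizes:
  assumes "A *v xstar = b" "rs k \<noteq> 0" "z \<in> V (Suc k)" "z \<noteq> nearest xstar (Suc k)"
  shows "norm (nearest xstar (Suc k) - xstar) < norm (z - xstar)"
proof -
  let ?y = "nearest xstar (Suc k)"
  \<comment> \<open>The normal equations of the projection. One value of \<open>CG_tau\<close>
    solves all of them because neither inner product depends on \<open>j\<close>.\<close>
  have orth: "rs j \<bullet> (?y - xstar) = 0" if "j \<le> k" for j
  proof -
    have "rs j \<bullet> (?y - xstar)
        = CG_tau A b x0 xstar (Suc k) * (ps (Suc k) \<bullet> rs j) - (xstar - xs (Suc k)) \<bullet> rs j"
      by (simp add: nearest_def inner_commute[of "rs j"] algebra_simps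
          del: CG_r.simps CG_x.simps CG_p.simps)
    also have "\<dots> = 0"
      unfolding CG_tau_def error_energy[OF assms(1)]
        error_inner_residual[OF assms(1) le_SucI[OF that]] direction_inner_residual[OF that]
      using assms(2) by (simp add: power2_norm_eq_inner del: CG_r.simps)
    finally show ?thesis .
  qed
  have "(z - ?y) \<bullet> (?y - xstar) = 0"
    using diff_in_V[OF assms(3) nearest_in_V]
    by (rule orthogonal_span_left) (auto simp: orth less_Suc_eq_le)
  then have "(norm (z - xstar))\<^sup>2 = (norm (z - ?y))\<^sup>2 + (norm (?y - xstar))\<^sup>2"
    using norm_add_Pythagorean[of "z - ?y" "?y - xstar"] by (simp add: orthogonal_def)
  moreover have "(norm (z - ?y))\<^sup>2 > 0" using assms(4) by simp
  ultimately have "(norm (?y - xstar))\<^sup>2 < (norm (z - xstar))\<^sup>2" by linarith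
  then show ?thesis by (rule power_less_imp_less_base) simp
qed

section \<open>Agreement of the two algorithms\<close>

lemma IA_eq_CG:
  fixes xstar
  defines "f \<equiv> quad A b"
  assumes xstar: "A *v xstar = b"
    and "rs k \<noteq> 0"
  shows "IA_M f xstar x0 (Suc k) \<subseteq> V (Suc k)
    \<and> IA_x f xstar x0 (Suc k) = xs (Suc k)
    \<and> IA_y f xstar x0 (Suc k) = nearest xstar (Suc k)"
  using assms(3)
\<comment> \<open>All three claims are carried together, since each new affine set is built from the
  preceding \<open>IA_x\<close> and \<open>IA_y\<close>.\<close>
proof (induction k)
  case 0
  note [simp del] = CG_r.simps CG_x.simps CG_p.simps
  have "grad f x0 = - rs 0"
    by (simp add: f_def grad_quad CG_r.simps)
  \<comment> \<open>Up to the sign of its generator, the first set of IA is all of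
    \<open>V (Suc 0)\<close>.\<close>
  moreover have "span {- rs 0} = span {rs 0}"
    using span_neg[of "rs 0" "{rs 0}"] span_neg[of "- rs 0" "{- rs 0}"]
    unfolding span_eq by (simp add: span_base)
  ultimately have M: "IA_M f xstar x0 (Suc 0) = V (Suc 0)"
    by (simp add: CG_V_def lessThan_Suc affine_span_def)
  show ?case
    using 0 CG_x_in_V nearest_in_V CG_x_minimizes nearest_minimizes[OF xstar]
    unfolding IA_x.simps IA_y.simps M by (auto intro!: arg_min_on_eqI simp: f_def)
next
  case (Suc k)
  note [simp del] = CG_r.simps CG_x.simps CG_p.simps
  let ?\<tau> = "CG_tau A b x0 xstar (Suc k)"
  \<comment> \<open>By contraposition: a zero residual gives a zero direction, hence a zero next
    residual.\<close>
  have rk: "rs k \<noteq> 0" using Suc.prems direction_eq_0[of k] by (auto simp: CG_r.simps)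
  note IH = Suc.IH[OF rk]
  have "grad f (xs (Suc k)) = - rs (Suc k)"
    by (simp add: f_def grad_quad residual)
  then have M: "IA_M f xstar x0 (Suc (Suc k))
      = affine_span (xs (Suc k)) {?\<tau> *\<^sub>R ps (Suc k), - rs (Suc k)}" (is "_ = affine_span _ ?S")
    using IH by (simp add: nearest_def del: IA_x.simps IA_y.simps)
  have sub: "affine_span (xs (Suc k)) ?S \<subseteq> V (Suc (Suc k))"
    using CG_x_in_V[of "Suc k" "Suc (Suc k)"] direction_in_span[of "Suc k" "Suc (Suc k)"]
      residual_in_span[of "Suc k" "Suc (Suc k)"]
    unfolding CG_V_def by (intro affine_span_subsetI) (auto simp: span_scale span_neg)
  \<comment> \<open>Positivity of \<open>?\<tau>\<close> allows dividing by it; otherwise the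
    direction could be lost from the span.\<close>
  have "ps (Suc k) \<in> span ?S"
    using CG_tau_pos[OF xstar rk Suc.prems] span_scale[of "?\<tau> *\<^sub>R ps (Suc k)" ?S "1 / ?\<tau>"]
    by (simp add: span_base)
  moreover have "rs (Suc k) \<in> span ?S"
    using span_neg[of "- rs (Suc k)" ?S] by (simp add: span_base)
  ultimately have p: "ps (Suc (Suc k)) \<in> span ?S"
    by (simp add: CG_p.simps span_add span_scale)
  have x_in: "xs (Suc (Suc k)) \<in> affine_span (xs (Suc k)) ?S"
    using p by (simp add: CG_x.simps(2)[of _ _ _ "Suc k"] mem_affine_span_iff span_scale)
  then have y_in: "nearest xstar (Suc (Suc k)) \<in> affine_span (xs (Suc k)) ?S"
    using span_add[OF _ span_scale[OF p], of "xs (Suc (Suc k)) - xs (Suc k)"]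
    by (simp add: nearest_def mem_affine_span_iff algebra_simps)
  \<comment> \<open>Strict minimizers over \<open>V (Suc (Suc k))\<close> that lie in the smaller
    set of IA are also its minimizers.\<close>
  show ?case
    using sub x_in y_in CG_x_minimizes nearest_minimizes[OF xstar Suc.prems]
    unfolding IA_x.simps IA_y.simps M by (auto intro!: arg_min_on_eqI simp: f_def)
qed

end

theorem theorem7:
  fixes A :: "real^'n^'n" and b x0 xstar :: "real^'n" and f :: "real^'n \<Rightarrow> real" and k :: nat
  assumes sym: "transpose A = A"
    and posdef: "\<And>x. x \<noteq> 0 \<Longrightarrow> x \<bullet> (A *v x) > 0"
    and f_def: "f = quad A b"
    and xstar: "is_arg_min f (\<lambda>x. True) xstar"
    and k: "k \<ge> 1"
    and not_terminated: "CG_r A b x0 (k - 1) \<noteq> 0"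
  shows "IA_M f xstar x0 k \<subseteq> CG_V A b x0 k
    \<and> CG_x A b x0 k = IA_x f xstar x0 k
    \<and> IA_y f xstar x0 k = CG_x A b x0 k + CG_tau A b x0 xstar k *\<^sub>R CG_p A b x0 k"
proof -
  interpret cg A b x0 by unfold_locales (use sym posdef in auto)
  show ?thesis
    using IA_eq_CG[of xstar "k - 1"] minimizer_quad[of b xstar] xstar k not_terminated
    by (simp add: f_def nearest_def)
qed

end
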